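(* Let $(M,g)$ be a finite-dimensional Riemannian manifold, $H\in\mathcal{F}(M)$, $\Omega$ a skew-symmetric $(1,1)$ tensor field on $M$, and consider the ODE $\dot u=\Omega(u)\,\mathrm{grad}\,H(u)$ on $M$. Let $\phi$ be a retraction and $c$ a center point. Let $\mathsf{c}_1,\dots,\mathsf{c}_s$ be distinct real numbers such that the associated weights $b_1,\dots,b_s$ are all nonzero. Then the energy-preserving collocation-like method $u^0\mapsto u^1$ with nodes $\mathsf{c}_1,\dots,\mathsf{c}_s$ and step size $h>0$ (defined in the context) satisfies $H(u^1)=H(u^0)$; consequently, if $(u^k)_{k\ge 0}$ is obtained by repeated application of the method, then $H(u^k)=H(u^0)$ for all $k\in\mathbb{N}$.
   Context: $\mathcal{F}(M)$ is the space of smooth real-valued functions on $M$; $\mathrm{grad}\,H$ is the Riemannian gradient, $\langle \mathrm{d}H,\cdot\rangle=g(\mathrm{grad}\,H,\cdot)$. The tensor field $\Omega$ assigns to each $u\in M$ a linear map $\Omega(u):T_uM\to T_uM$; skew-symmetric means $g(y,\Omega(u)y)=0$ for all $y\in T_uM$. Retraction: a smooth map $\phi:TM\to M$, with $\phi_p$ its restriction to $T_pM$ and $0_p$ the zero vector of $T_pM$, such that for every $p\in M$: (1) $\phi_p$ is defined in an open ball $B_{r_p}(0_p)\subset T_pM$ of radius $r_p$ about $0_p$; (2) $\phi_p(x)=p$ if and only if $x=0_p$; (3) $T\phi_p|_{0_p}=\mathrm{Id}_{T_pM}$. Here $\phi_p^{-1}$ is the (local) inverse of $\phi_p$ near $0_p$;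 all points and tangent vectors below are understood to lie where $\phi_p$ and $\phi_p^{-1}$ are mutually inverse diffeomorphisms. $T_x\phi_p:T_pM\to T_{\phi_p(x)}M$ and $T_U\phi_p^{-1}:T_UM\to T_pM$ denote tangent maps, and a superscript $\mathrm{T}$ denotes the adjoint with respect to $g$, e.g. $g((T_x\phi_p)^{\mathrm T}a,b)=g(a,T_x\phi_p\,b)$ for $a\in T_{\phi_p(x)}M$, $b\in T_pM$. The center point of a step is $c=c(u^0,u^1)\in M$, where $c:M\times M\to M$ is continuous with $c(u,u)=u$ for all $u\in M$. Nodes and weights: $l_i(\xi)=\prod_{j=1,j\ne i}^s\frac{\xi-\mathsf{c}_j}{\mathsf{c}_i-\mathsf{c}_j}$ and $b_i=\int_0^1 l_i(\xi)\,d\xi$. Energy-preserving collocation-like method: a step from $u^0\in M$ with step size $h$ is defined via a polynomial $\sigma:\mathbb{R}\to T_cM$ of degree $s$ satisfying $$\sigma(0)=\phi_c^{-1}(u^0),\qquad \dot\sigma(\mathsf{c}_jh)=T_{U_j}\phi_c^{-1}\bigl(\Omega_j\,\mathrm{grad}_jH\bigr),\quad U_j:=\phi_c(\sigma(\mathsf{c}_jh)),\quad j=1,\dots,s,\qquad u^1:=\phi_c(\sigma(h)),$$ where $\dot\sigma$ is the derivative of $\sigma$ with respect to its argument, $\Omega_j:=\Omega(U_j)$ and $$\mathrm{grad}_jH:=\int_0^1\frac{l_j(\xi)}{b_j}\,\bigl(T_{U_j}\phi_c^{-1}\bigr)^{\mathrm T}\bigl(T_{\sigma(\xi h)}\phi_c\bigr)^{\mathrm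 T}\,\mathrm{grad}\,H\bigl(\phi_c(\sigma(\xi h))\bigr)\,d\xi .$$ Equivalently, $\sigma(\tau h)=\phi_c^{-1}(u^0)+h\sum_{j=1}^s\int_0^\tau l_j(\xi)\,d\xi\;T_{U_j}\phi_c^{-1}(\Omega_j\,\mathrm{grad}_jH)$. *)

theory Defs
  imports "HOL-Analysis.Analysis"
begin

section \<open>Smooth maps between open subsets of normed spaces\<close>

text \<open>
  Only used for open sets \<open>S\<close> and finite-dimensional domains, where continuity of all iterated
  directional derivatives is the usual notion of class \<open>C\<^sup>k\<close>.
\<close>

primrec Ck_on :: "nat \<Rightarrow> 'a::real_normed_vector set \<Rightarrow> ('a \<Rightarrow> 'b::real_normed_vector) \<Rightarrow> bool" where
  "Ck_on 0 S f \<longleftrightarrow> continuous_on S f"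
| "Ck_on (Suc n) S f \<longleftrightarrow> (\<forall>x\<in>S. f differentiable (at x)) \<and>
     (\<forall>v. Ck_on n S (\<lambda>x. frechet_derivative f (at x) v))"

definition smooth_on :: "'a::real_normed_vector set \<Rightarrow> ('a \<Rightarrow> 'b::real_normed_vector) \<Rightarrow> bool" where
  "smooth_on S f \<longleftrightarrow> (\<forall>n. Ck_on n S f)"


section \<open>Smooth manifolds\<close>

text \<open>
  A chart is a pair of its domain and its coordinate map. The model space \<open>'e\<close> is a
  finite-dimensional normed space; \<open>banach\<close> is automatic in finite dimension. The class
  \<open>euclidean_space\<close> is avoided because it excludes dimension \<open>0\<close>.
\<close>

type_synonym ('a, 'e) chart = "'a set \<times> ('a \<Rightarrow> 'e)"

definition smooth_manifold :: "'a topology \<Rightarrow> ('a, 'e::banach) chart set \<Rightarrow> bool" where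
  "smooth_manifold X A \<longleftrightarrow>
     (\<exists>B::'e set. finite B \<and> span B = UNIV) \<and>
     Hausdorff_space X \<and> second_countable X \<and>
     (\<forall>(U, k)\<in>A. openin X U \<and> open (k ` U) \<and>
        homeomorphic_map (subtopology X U) (top_of_set (k ` U)) k) \<and>
     topspace X = (\<Union>(U, k)\<in>A. U) \<and>
     (\<forall>(U, k)\<in>A. \<forall>(V, l)\<in>A. smooth_on (k ` (U \<inter> V)) (l \<circ> inv_into U k))"

text \<open>A finite-dimensional vector space as a manifold, with its single global chart.\<close>

definition vector_atlas :: "('e, 'e) chart set" where
  "vector_atlas = {(UNIV, id)}"

definition smooth_map ::
  "'a topology \<Rightarrow> ('a, 'e::real_normed_vector) chart set \<Rightarrow> 'a set \<Rightarrow>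
   'b topology \<Rightarrow> ('b, 'f::real_normed_vector) chart set \<Rightarrow> ('a \<Rightarrow> 'b) \<Rightarrow> bool" where
  "smooth_map X A S Y B f \<longleftrightarrow>
     openin X S \<and> continuous_map (subtopology X S) Y f \<and>
     (\<forall>(U, k)\<in>A. \<forall>(V, l)\<in>B. smooth_on (k ` (S \<inter> U \<inter> f -` V)) (l \<circ> f \<circ> inv_into U k))"

definition diffeo_on ::
  "'a topology \<Rightarrow> ('a, 'e::real_normed_vector) chart set \<Rightarrow> 'a set \<Rightarrow>
   'b topology \<Rightarrow> ('b, 'f::real_normed_vector) chart set \<Rightarrow> 'b set \<Rightarrow> ('a \<Rightarrow> 'b) \<Rightarrow> bool" where
  "diffeo_on X A S Y B T f \<longleftrightarrow>
     bij_betw f S T \<and> smooth_map X A S Y B f \<and> smooth_map Y B T X A (inv_into S f)"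


section \<open>Tangent spaces and tangent maps\<close>

text \<open>
  At each point \<open>p\<close> one chart \<open>chart_at A p\<close> of the atlas is selected, and a tangent vector at
  \<open>p\<close> is represented by its components in that chart. Thus every \<open>T\<^sub>pM\<close> is a copy of the model
  space \<open>'e\<close>; a pair \<open>(p, v)\<close> of type \<open>'a \<times> 'e\<close> is an element of the tangent bundle. Components in
  any other chart \<open>(U, k)\<close> around \<open>p\<close> are obtained by applying \<open>tangent_map A vector_atlas k p\<close>.
  The tangent map of \<open>f\<close> at \<open>p\<close> is the derivative of the representation of \<open>f\<close> in the charts
  selected at \<open>p\<close> and at \<open>f p\<close>. In a vector space, \<open>T\<^sub>xE = E\<close> canonically, via the global chart.
\<close>

definition chart_at :: "('a, 'e) chart set \<Rightarrow> 'a \<Rightarrow> ('a, 'e) chart" where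
  "chart_at A p = (SOME K. K \<in> A \<and> p \<in> fst K)"

definition coord_at :: "('a, 'e) chart set \<Rightarrow> 'a \<Rightarrow> 'a \<Rightarrow> 'e" where
  "coord_at A p = snd (chart_at A p)"

definition point_at :: "('a, 'e) chart set \<Rightarrow> 'a \<Rightarrow> 'e \<Rightarrow> 'a" where
  "point_at A p = inv_into (fst (chart_at A p)) (snd (chart_at A p))"

definition tangent_map ::
  "('a, 'e::real_normed_vector) chart set \<Rightarrow> ('b, 'f::real_normed_vector) chart set \<Rightarrow>
   ('a \<Rightarrow> 'b) \<Rightarrow> 'a \<Rightarrow> 'e \<Rightarrow> 'f" where
  "tangent_map A B f p =
     frechet_derivative (coord_at B (f p) \<circ> f \<circ> point_at A p) (at (coord_at A p p))"

definition tangent_atlas ::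
  "('a, 'e::real_normed_vector) chart set \<Rightarrow> ('a \<times> 'e, 'e \<times> 'e) chart set" where
  "tangent_atlas A =
     (\<lambda>(U, k). (U \<times> UNIV, \<lambda>(p, v). (k p, tangent_map A vector_atlas k p v))) ` A"

definition tangent_topology :: "('a, 'e::real_normed_vector) chart set \<Rightarrow> ('a \<times> 'e) topology" where
  "tangent_topology A =
     topology_generated_by {D \<inter> K -` W | D K W. (D, K) \<in> tangent_atlas A \<and> open W}"


section \<open>Riemannian metrics, gradients, adjoints\<close>

definition riemannian_manifold ::
  "'a topology \<Rightarrow> ('a, 'e::banach) chart set \<Rightarrow> ('a \<Rightarrow> 'e \<Rightarrow> 'e \<Rightarrow> real) \<Rightarrow> bool" where
  "riemannian_manifold X A g \<longleftrightarrow>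
     smooth_manifold X A \<and>
     (\<forall>p\<in>topspace X. bilinear (g p) \<and> (\<forall>v w. g p v w = g p w v) \<and> (\<forall>v. v \<noteq> 0 \<longrightarrow> 0 < g p v v)) \<and>
     (\<forall>(U, k)\<in>A. \<forall>v w. smooth_on (k ` U)
        (\<lambda>x. g (inv_into U k x) (tangent_map vector_atlas A (inv_into U k) x v)
                                (tangent_map vector_atlas A (inv_into U k) x w)))"

definition smooth_function :: "'a topology \<Rightarrow> ('a, 'e::banach) chart set \<Rightarrow> ('a \<Rightarrow> real) \<Rightarrow> bool" where
  "smooth_function X A H \<longleftrightarrow> smooth_map X A (topspace X) euclidean vector_atlas H"

definition gradient ::
  "('a, 'e::banach) chart set \<Rightarrow> ('a \<Rightarrow> 'e \<Rightarrow> 'e \<Rightarrow> real) \<Rightarrow> ('a \<Rightarrow> real) \<Rightarrow> 'a \<Rightarrow> 'e" where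
  "gradient A g H p = (THE v. \<forall>y. tangent_map A vector_atlas H p y = g p v y)"

text \<open>Adjoint \<open>T\<^sub>qM \<rightarrow> T\<^sub>pM\<close> of a linear map \<open>L : T\<^sub>pM \<rightarrow> T\<^sub>qM\<close>.\<close>

definition g_adjoint ::
  "('a \<Rightarrow> 'e \<Rightarrow> 'e \<Rightarrow> real) \<Rightarrow> 'a \<Rightarrow> 'a \<Rightarrow> ('e \<Rightarrow> 'e) \<Rightarrow> 'e \<Rightarrow> 'e" where
  "g_adjoint g p q L a = (THE v. \<forall>b. g p v b = g q a (L b))"

text \<open>
  No regularity in \<open>u\<close> is demanded of a tensor field, so smooth ones are covered in particular.
\<close>

definition tensor_field_1_1 ::
  "'a topology \<Rightarrow> ('a \<Rightarrow> 'e::real_vector \<Rightarrow> 'e) \<Rightarrow> bool" where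
  "tensor_field_1_1 X \<Omega> \<longleftrightarrow> (\<forall>u\<in>topspace X. linear (\<Omega> u))"

definition skew_symmetric_field ::
  "'a topology \<Rightarrow> ('a \<Rightarrow> 'e \<Rightarrow> 'e \<Rightarrow> real) \<Rightarrow> ('a \<Rightarrow> 'e \<Rightarrow> 'e) \<Rightarrow> bool" where
  "skew_symmetric_field X g \<Omega> \<longleftrightarrow> (\<forall>u\<in>topspace X. \<forall>y. g u y (\<Omega> u y) = 0)"


section \<open>Retractions and center points\<close>

text \<open>
  A retraction need not be defined on all of the tangent bundle: \<open>D\<close> is its (open) domain, which
  contains a \<open>g\<close>-ball about each zero vector. As \<open>\<phi> p 0 = p\<close>, the derivative at \<open>0\<close> is an
  endomorphism of \<open>T\<^sub>pM\<close>.
\<close>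

definition mfd_retraction ::
  "'a topology \<Rightarrow> ('a, 'e::banach) chart set \<Rightarrow> ('a \<Rightarrow> 'e \<Rightarrow> 'e \<Rightarrow> real) \<Rightarrow>
   ('a \<times> 'e) set \<Rightarrow> ('a \<Rightarrow> 'e \<Rightarrow> 'a) \<Rightarrow> bool" where
  "mfd_retraction X A g D \<phi> \<longleftrightarrow>
     smooth_map (tangent_topology A) (tangent_atlas A) D X A (\<lambda>(p, x). \<phi> p x) \<and>
     (\<forall>p\<in>topspace X.
        (\<exists>r>0. \<forall>x. sqrt (g p x x) < r \<longrightarrow> (p, x) \<in> D \<and> (\<phi> p x = p \<longleftrightarrow> x = 0)) \<and>
        (\<forall>v. tangent_map vector_atlas A (\<phi> p) 0 v = v))"

definition center_point :: "'a topology \<Rightarrow> ('a \<Rightarrow> 'a \<Rightarrow> 'a) \<Rightarrow> bool" where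
  "center_point X c \<longleftrightarrow>
     continuous_map (prod_topology X X) X (\<lambda>(u, v). c u v) \<and> (\<forall>u\<in>topspace X. c u u = u)"

text \<open>
  \<open>V\<close> is an open neighbourhood of \<open>0\<^sub>p\<close> on which \<open>\<phi> p\<close> is a diffeomorphism onto an open subset
  of \<open>M\<close>; the local inverse of \<open>\<phi> p\<close> is then \<open>inv_into V (\<phi> p)\<close>.
\<close>

definition inversion_domain ::
  "'a topology \<Rightarrow> ('a, 'e::banach) chart set \<Rightarrow> ('a \<times> 'e) set \<Rightarrow> ('a \<Rightarrow> 'e \<Rightarrow> 'a) \<Rightarrow>
   'a \<Rightarrow> 'e set \<Rightarrow> bool" where
  "inversion_domain X A D \<phi> p V \<longleftrightarrow>
     0 \<in> V \<and> {p} \<times> V \<subseteq> D \<and> diffeo_on euclidean vector_atlas V X A (\<phi> p ` V) (\<phi> p)"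


section \<open>Energy-preserving collocation-like methods\<close>

definition lagrange_poly :: "nat \<Rightarrow> (nat \<Rightarrow> real) \<Rightarrow> nat \<Rightarrow> real \<Rightarrow> real" where
  "lagrange_poly s cs i \<xi> = (\<Prod>j\<in>{1..s} - {i}. (\<xi> - cs j) / (cs i - cs j))"

definition quad_weight :: "nat \<Rightarrow> (nat \<Rightarrow> real) \<Rightarrow> nat \<Rightarrow> real" where
  "quad_weight s cs i = integral {0..1} (lagrange_poly s cs i)"

text \<open>As usual for collocation polynomials, ``of degree \<open>s\<close>'' means of degree at most \<open>s\<close>.\<close>

definition vector_poly :: "nat \<Rightarrow> (real \<Rightarrow> 'e::real_vector) \<Rightarrow> bool" where
  "vector_poly s \<sigma> \<longleftrightarrow> (\<exists>a. \<forall>t. \<sigma> t = (\<Sum>k\<le>s. t ^ k *\<^sub>R a k))"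

text \<open>
  The averaged gradient \<open>grad\<^sub>jH\<close> for center \<open>p\<close>; its value lies in the tangent space at
  \<open>U\<^sub>j = \<phi> p (\<sigma> (cs j * h))\<close>.
\<close>

definition avg_gradient ::
  "('a, 'e::banach) chart set \<Rightarrow> ('a \<Rightarrow> 'e \<Rightarrow> 'e \<Rightarrow> real) \<Rightarrow> ('a \<Rightarrow> real) \<Rightarrow> ('a \<Rightarrow> 'e \<Rightarrow> 'a) \<Rightarrow>
   nat \<Rightarrow> (nat \<Rightarrow> real) \<Rightarrow> real \<Rightarrow> 'a \<Rightarrow> 'e set \<Rightarrow> (real \<Rightarrow> 'e) \<Rightarrow> nat \<Rightarrow> 'e" where
  "avg_gradient A g H \<phi> s cs h p V \<sigma> j =
     (let U = \<phi> p (\<sigma> (cs j * h)) in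
      integral {0..1} (\<lambda>\<xi>. (lagrange_poly s cs j \<xi> / quad_weight s cs j) *\<^sub>R
        g_adjoint g U p (tangent_map A vector_atlas (inv_into V (\<phi> p)) U)
          (g_adjoint g p (\<phi> p (\<sigma> (\<xi> * h))) (tangent_map vector_atlas A (\<phi> p) (\<sigma> (\<xi> * h)))
            (gradient A g H (\<phi> p (\<sigma> (\<xi> * h)))))))"

text \<open>
  The method is implicit (already the center depends on \<open>u1\<close>), so a step is a relation between
  \<open>u0\<close> and \<open>u1\<close>.
\<close>

definition ep_collocation_step ::
  "'a topology \<Rightarrow> ('a, 'e::banach) chart set \<Rightarrow> ('a \<Rightarrow> 'e \<Rightarrow> 'e \<Rightarrow> real) \<Rightarrow> ('a \<Rightarrow> real) \<Rightarrow>
   ('a \<Rightarrow> 'e \<Rightarrow> 'e) \<Rightarrow> ('a \<times> 'e) set \<Rightarrow> ('a \<Rightarrow> 'e \<Rightarrow> 'a) \<Rightarrow> ('a \<Rightarrow> 'a \<Rightarrow> 'a) \<Rightarrow>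
   nat \<Rightarrow> (nat \<Rightarrow> real) \<Rightarrow> real \<Rightarrow> 'a \<Rightarrow> 'a \<Rightarrow> bool" where
  "ep_collocation_step X A g H \<Omega> D \<phi> c s cs h u0 u1 \<longleftrightarrow>
     u0 \<in> topspace X \<and> u1 \<in> topspace X \<and>
     (\<exists>p V \<sigma>. p = c u0 u1 \<and> inversion_domain X A D \<phi> p V \<and> vector_poly s \<sigma> \<and>
        u0 \<in> \<phi> p ` V \<and> (\<forall>\<xi>\<in>{0..1}. \<sigma> (\<xi> * h) \<in> V) \<and> (\<forall>j\<in>{1..s}. \<sigma> (cs j * h) \<in> V) \<and>
        \<sigma> 0 = inv_into V (\<phi> p) u0 \<and>
        (\<forall>j\<in>{1..s}. let U = \<phi> p (\<sigma> (cs j * h)) in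
           vector_derivative \<sigma> (at (cs j * h)) =
             tangent_map A vector_atlas (inv_into V (\<phi> p)) U
               (\<Omega> U (avg_gradient A g H \<phi> s cs h p V \<sigma> j))) \<and>
        u1 = \<phi> p (\<sigma> h))"

end

(*
  In the tangent space at the center, H(u1) - H(u0) is the integral of the derivative of H o phi_c
  along the polynomial sigma. As sigma' has degree below s, it is interpolated exactly by its values
  at the nodes; by the definition of the adjoints and of grad_j H, the contribution of node j is then
  h b_j g(grad_j H, Omega_j grad_j H) = 0.
*)
theory Submission
  imports Defs
begin

section \<open>Finite-dimensional linear algebra: boundedness and Riesz representation\<close>

text \<open>By compactness of the coordinate sphere, the \<open>l1\<close> norm of the coordinates
  in a basis \<open>C\<close> is at most a constant times \<open>norm x\<close>. Finite dimension is
  available only as a finite spanning set, so boundedness is derived from that. It later lets the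
  metric be moved inside an integral.\<close>

lemma linear_imp_bounded_linear_finite_span:
  fixes f :: "'e::real_normed_vector \<Rightarrow> 'f::real_normed_vector"
  assumes f: "linear f" and B: "finite B" "span B = (UNIV :: 'e set)"
  shows "bounded_linear f"
proof -
  obtain C where C: "C \<subseteq> B" "independent C" "B \<subseteq> span C"
    using maximal_independent_subset by blast
  have finC: "finite C" using C(1) B(1) finite_subset by blast
  have "span B \<subseteq> span C" using C(3) span_minimal subspace_span by blast
  then have spanC: "x \<in> span C" for x using B(2) by blast
  \<comment> \<open>Coordinate vectors are functions on the whole type under the product topology.
    Pinning them to 0 outside \<open>C\<close> makes every factor compact, so Tychonoff applies to
    the box.\<close>
  define K where "K = Pi\<^sub>E UNIV (\<lambda>b. if b \<in> C then {-1..1} else {0}) \<inter> {q :: 'e \<Rightarrow> real. (\<Sum>b\<in>C. \<bar>q b\<bar>) = 1}"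
  define T where "T q = (\<Sum>b\<in>C. q b *\<^sub>R b)" for q :: "'e \<Rightarrow> real"
  have coord: "continuous_on S (\<lambda>q :: 'e \<Rightarrow> real. q b)" for b S
    by (rule continuous_on_subset[OF continuous_on_product_coordinates]) simp
  \<comment> \<open>\<open>K\<close> is the \<open>l\<^sub>1\<close> unit sphere of coordinate vectors; \<open>\<parallel>T\<parallel>\<close> is bounded away from 0 on it.\<close>
  have "compactin (product_topology (\<lambda>b. euclidean) UNIV)
      (Pi\<^sub>E UNIV (\<lambda>b::'e. if b \<in> C then {-1..1::real} else {0}))"
    by (subst compactin_PiE) auto
  then have "compact (Pi\<^sub>E UNIV (\<lambda>b::'e. if b \<in> C then {-1..1::real} else {0}))"
    by (simp add: euclidean_product_topology)
  moreover have "closed {q :: 'e \<Rightarrow> real. (\<Sum>b\<in>C. \<bar>q b\<bar>) = 1}"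
    by (intro closed_Collect_eq continuous_intros coord)
  ultimately have K: "compact K" unfolding K_def by blast
  have contT: "continuous_on K (\<lambda>q. norm (T q))"
    unfolding T_def by (intro continuous_intros coord)
  have T0: "T q \<noteq> 0" if "q \<in> K" for q
  proof
    assume "T q = 0"
    then have "\<forall>b\<in>C. q b = 0"
      using C(2) finC unfolding T_def dependent_finite[OF finC] by blast
    then show False using that by (simp add: K_def)
  qed
  \<comment> \<open>\<open>K\<close> is empty exactly in dimension 0; any positive \<open>m\<close>
    then serves.\<close>
  obtain m where m: "m > 0" "\<And>q. q \<in> K \<Longrightarrow> m \<le> norm (T q)"
  proof (cases "K = {}")
    case True
    then show ?thesis using that[of 1] by auto
  next
    case False
    then obtain q where "q \<in> K" "\<forall>r\<in>K. norm (T q) \<le> norm (T r)"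
      using continuous_attains_inf[OF K _ contT] by blast
    then show ?thesis using that[of "norm (T q)"] T0 by auto
  qed
  have "norm (f x) \<le> norm x * ((\<Sum>b\<in>C. norm (f b)) / m)" for x
  proof -
    define r where "r = representation C x"
    define S where "S = (\<Sum>b\<in>C. \<bar>r b\<bar>)"
    have x: "x = (\<Sum>b\<in>C. r b *\<^sub>R b)"
      using sum_representation_eq[OF C(2) spanC finC, of x] by (simp add: r_def)
    have S0: "S \<ge> 0" by (simp add: S_def sum_nonneg)
    have le: "\<bar>r b\<bar> \<le> S" if "b \<in> C" for b
      unfolding S_def using finC that by (intro member_le_sum) auto
    have mS: "m * S \<le> norm x"
    proof (cases "S = 0")
      case False
      with S0 have S: "S > 0" by simp
      \<comment> \<open>Dividing the coordinates by their \<open>l1\<close> norm \<open>S\<close>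
        moves them into \<open>K\<close>, where the lower bound \<open>m\<close> holds; scaling back
        gives \<open>m * S\<close> as a lower bound for \<open>norm x\<close>.\<close>
      let ?q = "\<lambda>b. if b \<in> C then r b / S else 0"
      have "(\<Sum>b\<in>C. \<bar>?q b\<bar>) = (\<Sum>b\<in>C. \<bar>r b\<bar>) / S"
        using S by (simp add: sum_divide_distrib)
      moreover have "- S \<le> r b \<and> r b \<le> S" if "b \<in> C" for b
        using le[OF that] by linarith
      ultimately have "?q \<in> K"
        using S unfolding K_def by (auto simp: S_def[symmetric] field_simps)
      moreover have "T ?q = (1 / S) *\<^sub>R x"
        unfolding T_def x by (simp add: scaleR_right.sum divide_inverse mult.commute)
      ultimately have "m \<le> norm ((1 / S) *\<^sub>R x)" using m(2) by metis
      then show ?thesis using S by (simp add: field_simps)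
    qed simp
    have "norm (f x) = norm (\<Sum>b\<in>C. r b *\<^sub>R f b)"
      by (subst x) (simp add: linear_sum[OF f] linear_scale[OF f])
    also have "\<dots> \<le> (\<Sum>b\<in>C. S * norm (f b))"
      by (rule sum_norm_le) (auto intro: mult_right_mono le)
    also have "\<dots> = S * (\<Sum>b\<in>C. norm (f b))" by (simp add: sum_distrib_left)
    also have "\<dots> \<le> (norm x / m) * (\<Sum>b\<in>C. norm (f b))"
      using mS m(1) by (intro mult_right_mono) (auto simp: field_simps sum_nonneg)
    finally show ?thesis by simp
  qed
  then show ?thesis
    by (intro bounded_linear_intro[OF linear_add[OF f] linear_scale[OF f]])
qed

text \<open>Existence is Gram-Schmidt by induction on the spanning set: a new vector is replaced by
  its component orthogonal to the old span, and the representing vector is corrected along that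
  component. Uniqueness is positivity of \<open>G\<close> on the difference. The argument is purely
  algebraic, so \<open>G\<close> may be the metric of any tangent space.\<close>

lemma riesz_finite_span:
  fixes G :: "'e::real_vector \<Rightarrow> 'e \<Rightarrow> real"
  assumes G: "bilinear G" and sym: "\<And>v w. G v w = G w v"
    and pos: "\<And>v. v \<noteq> 0 \<Longrightarrow> 0 < G v v"
    and f: "linear f" and B: "finite B" "span B = (UNIV :: 'e set)"
  shows "\<exists>!v. \<forall>b. G v b = f b"
proof -
  have l: "linear (\<lambda>v. G v w)" and r: "linear (G w)" for w
    using G by (auto simp: bilinear_def)
  have ex: "\<exists>v\<in>span S. \<forall>b\<in>span S. G v b = k b" if "finite S" "linear k" for S and k :: "'e \<Rightarrow> real"
    using that
  proof (induction S arbitrary: k rule: finite_induct)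
    case empty
    then show ?case using linear_0[OF r] linear_0 by fastforce
  next
    case (insert x S)
    obtain v where v: "v \<in> span S" "\<And>b. b \<in> span S \<Longrightarrow> G v b = k b"
      using insert.IH[OF insert.prems] by blast
    \<comment> \<open>The orthogonal projection \<open>w\<close> of \<open>x\<close> onto
      \<open>span S\<close> is itself a Riesz vector, for the functional \<open>G x\<close>; this is
      why the induction is over arbitrary \<open>k\<close>.\<close>
    obtain w where w: "w \<in> span S" "\<And>b. b \<in> span S \<Longrightarrow> G w b = G x b"
      using insert.IH[OF r[of x]] by blast
    define y where "y = x - w"
    have orth: "G y b = 0" if "b \<in> span S" for b
      using w(2)[OF that] by (simp add: y_def linear_diff[OF l])
    show ?case
    proof (cases "y = 0")
      case True
      then have "span (insert x S) = span S"
        using w(1) by (simp add: y_def span_redundant)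
      then show ?thesis using v by auto
    next
      case False
      \<comment> \<open>The coefficient is the one that forces \<open>G z y = k y\<close>. Since
        \<open>y\<close> is orthogonal to \<open>span S\<close>, the values already correct there do
        not change.\<close>
      define z where "z = v + ((k y - G v y) / G y y) *\<^sub>R y"
      have kz: "G z b = k b" if b: "b \<in> span (insert x S)" for b
      proof -
        from b obtain a where "b - a *\<^sub>R x \<in> span S" by (auto simp: span_insert)
        \<comment> \<open>Passing from \<open>x\<close> to \<open>y\<close> changes the vector by
          \<open>a *\<^sub>R w\<close>, which stays in \<open>span S\<close>.\<close>
        then have d: "b - a *\<^sub>R y \<in> span S"
          using span_add[OF _ span_scale[OF w(1)], of "b - a *\<^sub>R x" a]
          by (simp add: y_def algebra_simps)
        have "G z (b - a *\<^sub>R y) = k (b - a *\<^sub>R y)"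
          using v(2)[OF d] orth[OF d] by (simp add: z_def linear_add[OF l] linear_scale[OF l])
        moreover have "G z y = k y"
          using pos[OF False] by (simp add: z_def linear_add[OF l] linear_scale[OF l])
        ultimately show ?thesis
          by (simp add: linear_diff[OF r] linear_diff[OF insert.prems]
              linear_scale[OF r] linear_scale[OF insert.prems])
      qed
      have "span S \<subseteq> span (insert x S)" "x \<in> span (insert x S)"
        by (auto intro: span_mono[THEN subsetD] span_base)
      then have "z \<in> span (insert x S)"
        unfolding z_def y_def using v(1) w(1)
        by (intro span_add span_scale span_diff) auto
      with kz show ?thesis by blast
    qed
  qed
  have "v = w" if "\<forall>b. G v b = f b" "\<forall>b. G w b = f b" for v w
  proof (rule ccontr)
    assume "v \<noteq> w"
    then have "0 < G (v - w) (v - w)" by (intro pos) simp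
    also have "\<dots> = 0" using that by (simp add: linear_diff[OF l])
    finally show False by simp
  qed
  then show ?thesis using ex[OF B(1) f] B(2) by auto
qed

section \<open>Exactness of Lagrange interpolation\<close>

text \<open>As functions of \<open>x\<close>, both sides are polynomials of degree below
  \<open>s\<close> that agree at the \<open>s\<close> distinct nodes.\<close>

lemma lagrange_interpolation_power:
  assumes inj: "inj_on cs {1..s}" and k: "k < s"
  shows "(\<Sum>j\<in>{1..s}. lagrange_poly s cs j x * cs j ^ k) = x ^ k"
proof -
  define L where "L j = (\<Prod>i\<in>{1..s} - {j}. Polynomial.smult (1 / (cs j - cs i)) [:- cs i, 1:])" for j
  define P where "P = (\<Sum>j\<in>{1..s}. Polynomial.smult (cs j ^ k) (L j))"
  have pL: "poly (L j) x = lagrange_poly s cs j x" for j x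
    by (simp add: L_def lagrange_poly_def poly_prod diff_divide_distrib)
  have pP: "poly P x = (\<Sum>j\<in>{1..s}. lagrange_poly s cs j x * cs j ^ k)" for x
    by (simp add: P_def poly_sum pL mult.commute)
  have degL: "degree (L j) \<le> s - 1" if "j \<in> {1..s}" for j
  proof -
    have "degree (L j) \<le> (\<Sum>i\<in>{1..s} - {j}. degree (Polynomial.smult (1 / (cs j - cs i)) [:- cs i, 1:]))"
      unfolding L_def by (rule order.trans[OF degree_prod_sum_le]) simp_all
    also have "\<dots> \<le> (\<Sum>i\<in>{1..s} - {j}. 1)"
      by (intro sum_mono order.trans[OF degree_smult_le]) simp
    finally show ?thesis using that by simp
  qed
  have "degree P \<le> s - 1"
    unfolding P_def using degL
    by (intro degree_sum_le) (auto intro: order.trans[OF degree_smult_le])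
  \<comment> \<open>From \<open>k < s\<close> comes \<open>s > 0\<close>, so the truncated
    \<open>s - 1\<close> really is smaller than \<open>s\<close>.\<close>
  then have degP: "degree P < s" using k by simp
  have kron: "lagrange_poly s cs j (cs i) = (if i = j then 1 else 0)"
    if "i \<in> {1..s}" "j \<in> {1..s}" for i j
  proof (cases "i = j")
    case True
    then show ?thesis
      using that inj unfolding lagrange_poly_def
      by (auto intro!: prod.neutral simp: inj_on_eq_iff)
  next
    case False
    then show ?thesis
      using that unfolding lagrange_poly_def by (auto intro!: bexI[of _ i])
  qed
  have "P = Polynomial.monom 1 k"
  proof (rule poly_eqI_degree[where A = "cs ` {1..s}"])
    fix y assume "y \<in> cs ` {1..s}"
    then obtain i where i: "i \<in> {1..s}" "y = cs i" by blast
    have "poly P y = (\<Sum>j\<in>{1..s}. (if i = j then cs j ^ k else 0))"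
      unfolding pP i(2) by (intro sum.cong) (auto simp: kron[OF i(1)])
    also have "\<dots> = cs i ^ k" using i by simp
    finally show "poly P y = poly (Polynomial.monom 1 k) y" by (simp add: i poly_monom)
  qed (use degP k card_image[OF inj] in \<open>simp_all add: degree_monom_eq\<close>)
  then have "poly P x = x ^ k" by (simp add: poly_monom)
  then show ?thesis unfolding pP .
qed


section \<open>Charts, tangent maps and the chain rule\<close>

lemma smooth_manifold_finite_span:
  fixes A :: "('a, 'e::banach) chart set"
  assumes "smooth_manifold X A"
  obtains B :: "'e set" where "finite B" "span B = UNIV"
  using conjunct1[OF assms[unfolded smooth_manifold_def]] by blast

lemma chart_at_mem:
  assumes "smooth_manifold X A" and "p \<in> topspace X"
  shows "chart_at A p \<in> A" and "p \<in> fst (chart_at A p)"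
proof -
  have "\<exists>K. K \<in> A \<and> p \<in> fst K"
    using assms unfolding smooth_manifold_def by force
  then show "chart_at A p \<in> A" "p \<in> fst (chart_at A p)"
    unfolding chart_at_def by (metis (mono_tags, lifting) someI_ex)+
qed

text \<open>The atlas has one chart, so the choice in \<open>chart_at\<close> is forced and
  coordinates on a vector space disappear from all tangent maps.\<close>

lemma chart_at_vector_atlas [simp]: "chart_at vector_atlas x = (UNIV, id)"
  unfolding chart_at_def vector_atlas_def by (rule some_equality) auto

lemma chart_at_vector_atlas_mem:
  "chart_at vector_atlas x \<in> vector_atlas" "x \<in> fst (chart_at vector_atlas x)"
  unfolding chart_at_vector_atlas by (simp_all add: vector_atlas_def)

lemma coord_at_vector_atlas [simp]: "coord_at vector_atlas x = id"
  by (simp add: coord_at_def)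

lemma point_at_vector_atlas [simp]: "point_at vector_atlas x = id"
  by (simp add: point_at_def)

lemma point_at_coord_at:
  assumes "smooth_manifold X A" and "p \<in> topspace X" and "y \<in> fst (chart_at A p)"
  shows "point_at A p (coord_at A p y) = y"
proof -
  obtain U k where Uk: "chart_at A p = (U, k)" by fastforce
  then have "openin X U" "homeomorphic_map (subtopology X U) (top_of_set (k ` U)) k"
    using assms(1) chart_at_mem(1)[OF assms(1,2)] unfolding smooth_manifold_def by fastforce+
  then have "inj_on k (topspace X \<inter> U)" "U \<subseteq> topspace X"
    using homeomorphic_imp_injective_map openin_subset by fastforce+
  then show ?thesis
    using assms(3) Uk by (simp add: point_at_def coord_at_def Int_absorb1)
qed

text \<open>\<open>tangent_map\<close> is built from \<open>frechet_derivative\<close>, which means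
  something only where the map is differentiable; the first-order part of smoothness provides this.
  The chart conditions are separate assumptions so that manifolds and vector spaces can stand on
  either side.\<close>

lemma smooth_map_has_derivative:
  assumes f: "smooth_map X A S Y B f" and p: "p \<in> S"
    and A: "chart_at A p \<in> A" "p \<in> fst (chart_at A p)"
    and B: "chart_at B (f p) \<in> B" "f p \<in> fst (chart_at B (f p))"
  shows "((coord_at B (f p) \<circ> f \<circ> point_at A p) has_derivative tangent_map A B f p)
           (at (coord_at A p p))"
proof -
  obtain U k where Uk: "chart_at A p = (U, k)" by fastforce
  obtain W l where Wl: "chart_at B (f p) = (W, l)" by fastforce
  have "smooth_on (k ` (S \<inter> U \<inter> f -` W)) (l \<circ> f \<circ> inv_into U k)"
    using f A B Uk Wl unfolding smooth_map_def by fastforce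
  then have "Ck_on (Suc 0) (k ` (S \<inter> U \<inter> f -` W)) (l \<circ> f \<circ> inv_into U k)"
    unfolding smooth_on_def by blast
  moreover have "k p \<in> k ` (S \<inter> U \<inter> f -` W)" using p A B Uk Wl by auto
  ultimately have "(l \<circ> f \<circ> inv_into U k) differentiable (at (k p))" by auto
  then show ?thesis
    unfolding tangent_map_def
    by (simp add: Uk Wl coord_at_def point_at_def frechet_derivative_works)
qed

lemma smooth_map_vector_to_manifold:
  assumes X: "smooth_manifold X A" and f: "smooth_map euclidean vector_atlas V X A f" and x: "x \<in> V"
  shows "f x \<in> topspace X"
    and "((coord_at A (f x) \<circ> f) has_derivative tangent_map vector_atlas A f x) (at x)"
proof -
  have "continuous_map (top_of_set V) X f" using f by (simp add: smooth_map_def)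
  then show fx: "f x \<in> topspace X" using x by (auto simp: continuous_map_def)
  show "((coord_at A (f x) \<circ> f) has_derivative tangent_map vector_atlas A f x) (at x)"
    using smooth_map_has_derivative[OF f x chart_at_vector_atlas_mem chart_at_mem[OF X fx]] by simp
qed

lemma smooth_map_manifold_to_vector:
  assumes X: "smooth_manifold X A" and f: "smooth_map X A S euclidean vector_atlas f"
    and p: "p \<in> S"
  shows "((f \<circ> point_at A p) has_derivative tangent_map A vector_atlas f p) (at (coord_at A p p))"
proof -
  have "openin X S" using f by (simp add: smooth_map_def)
  then have "p \<in> topspace X" using p openin_subset by blast
  then show ?thesis
    using smooth_map_has_derivative[OF f p chart_at_mem[OF X] chart_at_vector_atlas_mem] by simp
qed

text \<open>Inserting the chart selected at \<open>f x\<close> splits \<open>H \<circ> f\<close>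
  into two maps between normed spaces, to which the ordinary chain rule applies.\<close>

lemma has_derivative_smooth_function_comp:
  assumes X: "smooth_manifold X A" and f: "smooth_map euclidean vector_atlas V X A f"
    and H: "smooth_function X A H" and x: "x \<in> V"
  shows "((H \<circ> f) has_derivative
           (tangent_map A vector_atlas H (f x) \<circ> tangent_map vector_atlas A f x)) (at x)"
proof -
  note fx = smooth_map_vector_to_manifold[OF X f x]
  have "((H \<circ> point_at A (f x)) has_derivative tangent_map A vector_atlas H (f x))
          (at ((coord_at A (f x) \<circ> f) x))"
    using smooth_map_manifold_to_vector[OF X H[unfolded smooth_function_def] fx(1)] by simp
  from diff_chain_at[OF fx(2) this]
  have d: "((H \<circ> point_at A (f x) \<circ> (coord_at A (f x) \<circ> f)) has_derivative
      (tangent_map A vector_atlas H (f x) \<circ> tangent_map vector_atlas A f x)) (at x)" .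
  \<comment> \<open>The inserted chart and its inverse cancel only over the chart domain, so the two
    functions agree only on this preimage, which is open by continuity of \<open>f\<close>.\<close>
  let ?N = "{y \<in> V. f y \<in> fst (chart_at A (f x))}"
  have "openin X (fst (chart_at A (f x)))"
    using chart_at_mem(1)[OF X fx(1)] X unfolding smooth_manifold_def by fastforce
  then have "openin (top_of_set V) ?N"
    using f openin_continuous_map_preimage unfolding smooth_map_def by fastforce
  moreover have "open V" using f by (simp add: smooth_map_def)
  ultimately have "open ?N" by (simp add: openin_open_eq)
  then show ?thesis
  proof (rule has_derivative_transform_within_open[OF d])
    show "x \<in> ?N" using x chart_at_mem(2)[OF X fx(1)] by simp
    show "(H \<circ> point_at A (f x) \<circ> (coord_at A (f x) \<circ> f)) y = (H \<circ> f) y" if "y \<in> ?N" for y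
      using that point_at_coord_at[OF X fx(1)] by simp
  qed
qed


section \<open>Derivatives of polynomial curves\<close>

lemma vector_poly_has_vector_derivative:
  fixes \<sigma> :: "real \<Rightarrow> 'e::real_normed_vector"
  assumes "\<And>t. \<sigma> t = (\<Sum>k\<le>s. t ^ k *\<^sub>R a k)"
  shows "(\<sigma> has_vector_derivative (\<Sum>k\<le>s. (real k * t ^ (k - 1)) *\<^sub>R a k)) (at t)"
proof -
  have "((\<lambda>t. t ^ k *\<^sub>R a k) has_vector_derivative (real k * t ^ (k - 1)) *\<^sub>R a k) (at t)" for k
    by (rule has_vector_derivative_eq_rhs,
        (rule has_vector_derivative_scaleR DERIV_power DERIV_ident has_vector_derivative_const)+) simp
  then have "((\<lambda>t. \<Sum>k\<le>s. t ^ k *\<^sub>R a k) has_vector_derivative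
      (\<Sum>k\<le>s. (real k * t ^ (k - 1)) *\<^sub>R a k)) (at t)"
    by (intro has_vector_derivative_sum) auto
  moreover have "\<sigma> = (\<lambda>t. \<Sum>k\<le>s. t ^ k *\<^sub>R a k)" using assms by blast
  ultimately show ?thesis by simp
qed

lemma vector_poly_differentiable:
  fixes \<sigma> :: "real \<Rightarrow> 'e::real_normed_vector"
  assumes "vector_poly s \<sigma>"
  shows "(\<sigma> has_vector_derivative vector_derivative \<sigma> (at t)) (at t)"
proof -
  obtain a where "\<And>t. \<sigma> t = (\<Sum>k\<le>s. t ^ k *\<^sub>R a k)"
    using assms unfolding vector_poly_def by blast
  from vector_poly_has_vector_derivative[OF this]
  show ?thesis by (metis vector_derivative_at)
qed

text \<open>The derivative has degree below \<open>s\<close>, so interpolation at \<open>s\<close>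
  nodes is exact. This is checked coefficient by coefficient; the step size enters each monomial
  only as a common factor \<open>h ^ (k - 1)\<close>.\<close>

lemma vector_derivative_vector_poly_interpolation:
  fixes \<sigma> :: "real \<Rightarrow> 'e::real_normed_vector"
  assumes \<sigma>: "vector_poly s \<sigma>" and inj: "inj_on cs {1..s}"
  shows "vector_derivative \<sigma> (at (x * h)) =
    (\<Sum>j\<in>{1..s}. lagrange_poly s cs j x *\<^sub>R vector_derivative \<sigma> (at (cs j * h)))"
proof -
  obtain a where a: "\<And>t. \<sigma> t = (\<Sum>k\<le>s. t ^ k *\<^sub>R a k)"
    using \<sigma> unfolding vector_poly_def by blast
  have d: "vector_derivative \<sigma> (at t) = (\<Sum>k\<le>s. (real k * t ^ (k - 1)) *\<^sub>R a k)" for t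
    using vector_poly_has_vector_derivative[OF a] by (rule vector_derivative_at)
  have "(\<Sum>j\<in>{1..s}. lagrange_poly s cs j x *\<^sub>R vector_derivative \<sigma> (at (cs j * h))) =
      (\<Sum>k\<le>s. (\<Sum>j\<in>{1..s}. lagrange_poly s cs j x * (real k * (cs j * h) ^ (k - 1))) *\<^sub>R a k)"
    unfolding d scaleR_sum_right scaleR_sum_left scaleR_scaleR by (rule sum.swap)
  also have "\<dots> = (\<Sum>k\<le>s. (real k * (x * h) ^ (k - 1)) *\<^sub>R a k)"
  proof (rule sum.cong[OF refl])
    fix k assume k: "k \<in> {..s}"
    have "(\<Sum>j\<in>{1..s}. lagrange_poly s cs j x * (real k * (cs j * h) ^ (k - 1))) =
        real k * h ^ (k - 1) * (\<Sum>j\<in>{1..s}. lagrange_poly s cs j x * cs j ^ (k - 1))"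
      unfolding sum_distrib_left by (intro sum.cong) (auto simp: power_mult_distrib algebra_simps)
    also have "\<dots> = real k * (x * h) ^ (k - 1)"
    \<comment> \<open>For \<open>k = 0\<close> the exponent \<open>k - 1\<close> is truncated to 0,
      but the factor \<open>real k\<close> annihilates both sides.\<close>
    proof (cases "k = 0")
      case False
      then show ?thesis using k lagrange_interpolation_power[OF inj, of "k - 1" x]
        by (simp add: power_mult_distrib)
    qed simp
    finally show "(\<Sum>j\<in>{1..s}. lagrange_poly s cs j x * (real k * (cs j * h) ^ (k - 1))) *\<^sub>R a k =
      (real k * (x * h) ^ (k - 1)) *\<^sub>R a k" by simp
  qed
  finally show ?thesis by (simp add: d)
qed

section \<open>Gradients and adjoints with respect to the metric\<close>

text \<open>Unique existence of the Riesz vector gives the definite descriptions their meaning. Two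
  forms appear because \<open>gradient\<close> and \<open>g_adjoint\<close> orient the defining
  equation differently.\<close>

lemma riemannian_riesz:
  fixes A :: "('a, 'e::banach) chart set"
  assumes M: "riemannian_manifold X A g" and p: "p \<in> topspace X" and f: "linear f"
  shows "g p (THE v. \<forall>b. f b = g p v b) w = f w" and "g p (THE v. \<forall>b. g p v b = f b) w = f w"
proof -
  have G: "bilinear (g p)" "\<And>v w. g p v w = g p w v" "\<And>v. v \<noteq> 0 \<Longrightarrow> 0 < g p v v"
    using M p unfolding riemannian_manifold_def by blast+
  have "smooth_manifold X A" using M by (simp add: riemannian_manifold_def)
  then obtain B :: "'e set" where "finite B" "span B = UNIV"
    by (rule smooth_manifold_finite_span)
  then have "\<exists>!v. \<forall>b. g p v b = f b" using riesz_finite_span[OF G f] by blast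
  then have "\<forall>b. g p (THE v. \<forall>b. g p v b = f b) b = f b" by (rule theI')
  then show "g p (THE v. \<forall>b. g p v b = f b) w = f w" "g p (THE v. \<forall>b. f b = g p v b) w = f w"
    by (simp_all add: eq_commute[of "f _"])
qed

lemma g_gradient:
  assumes "riemannian_manifold X A g" "p \<in> topspace X" "linear (tangent_map A vector_atlas H p)"
  shows "g p (gradient A g H p) w = tangent_map A vector_atlas H p w"
  unfolding gradient_def using riemannian_riesz(1)[OF assms] .

lemma g_g_adjoint:
  assumes M: "riemannian_manifold X A g" and p: "p \<in> topspace X" and q: "q \<in> topspace X"
    and L: "linear L"
  shows "g p (g_adjoint g p q L a) b = g q a (L b)"
proof -
  have "linear (g q a)"
    using M q unfolding riemannian_manifold_def bilinear_def by blast
  then have "linear (\<lambda>b. g q a (L b))"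
    using linear_compose[OF L] by (simp add: o_def)
  from riemannian_riesz(2)[OF M p this] show ?thesis unfolding g_adjoint_def .
qed

section \<open>Energy balance of a step\<close>

lemma ep_collocation_step_preserves:
  fixes A :: "('a, 'e::banach) chart set"
  assumes M: "riemannian_manifold X A g"
    and H: "smooth_function X A H"
    and \<Omega>: "tensor_field_1_1 X \<Omega>" "skew_symmetric_field X g \<Omega>"
    and c: "center_point X c"
    and inj: "inj_on cs {1..s}"
    and weights: "\<forall>i\<in>{1..s}. quad_weight s cs i \<noteq> 0"
    and step: "ep_collocation_step X A g H \<Omega> D \<phi> c s cs h u0 u1"
  shows "H u1 = H u0"
proof -
  have X: "smooth_manifold X A" using M by (simp add: riemannian_manifold_def)
  obtain B :: "'e set" where B: "finite B" "span B = UNIV"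
    by (rule smooth_manifold_finite_span[OF X])
  obtain p V \<sigma> where p: "p = c u0 u1" and u01: "u0 \<in> topspace X" "u1 \<in> topspace X"
    and inv: "inversion_domain X A D \<phi> p V" and \<sigma>: "vector_poly s \<sigma>"
    and u0: "u0 \<in> \<phi> p ` V" "\<sigma> 0 = inv_into V (\<phi> p) u0"
    and V: "\<And>\<xi>. \<xi> \<in> {0..1} \<Longrightarrow> \<sigma> (\<xi> * h) \<in> V" "\<And>j. j \<in> {1..s} \<Longrightarrow> \<sigma> (cs j * h) \<in> V"
    and d\<sigma>: "\<And>j. j \<in> {1..s} \<Longrightarrow> vector_derivative \<sigma> (at (cs j * h)) =
      tangent_map A vector_atlas (inv_into V (\<phi> p)) (\<phi> p (\<sigma> (cs j * h)))
        (\<Omega> (\<phi> p (\<sigma> (cs j * h))) (avg_gradient A g H \<phi> s cs h p V \<sigma> j))"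
    and u1: "u1 = \<phi> p (\<sigma> h)"
    using step unfolding ep_collocation_step_def Let_def
    by (elim conjE exE) (rule that; (assumption | blast))
  \<comment> \<open>Both adjoints in the averaged gradient involve the metric at the center, so the
    center must be a point of the manifold.\<close>
  have pX: "p \<in> topspace X"
  proof -
    have "continuous_map (prod_topology X X) X (\<lambda>(u, v). c u v)"
      using c by (simp add: center_point_def)
    from funcset_mem[OF continuous_map_funspace[OF this], of "(u0, u1)"]
    show ?thesis using u01 by (simp add: p)
  qed
  have \<phi>: "smooth_map euclidean vector_atlas V X A (\<phi> p)"
    and \<phi>_inv: "smooth_map X A (\<phi> p ` V) euclidean vector_atlas (inv_into V (\<phi> p))"
    using inv unfolding inversion_domain_def diffeo_on_def by auto
  note \<phi>X = smooth_map_vector_to_manifold(1)[OF X \<phi>]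
  have lin_\<phi>: "linear (tangent_map vector_atlas A (\<phi> p) x)" if "x \<in> V" for x
    using smooth_map_vector_to_manifold(2)[OF X \<phi> that] has_derivative_linear by blast
  have lin_inv: "linear (tangent_map A vector_atlas (inv_into V (\<phi> p)) (\<phi> p x))" if "x \<in> V" for x
    using smooth_map_manifold_to_vector[OF X \<phi>_inv] that has_derivative_linear by blast
  have lin_H: "linear (tangent_map A vector_atlas H q)" if "q \<in> topspace X" for q
    using smooth_map_manifold_to_vector[OF X H[unfolded smooth_function_def]] that
      has_derivative_linear by blast
  define dF where "dF x = tangent_map A vector_atlas H (\<phi> p x) \<circ> tangent_map vector_atlas A (\<phi> p) x"
    for x
  have dF: "((H \<circ> \<phi> p) has_derivative dF x) (at x)" if "x \<in> V" for x
    unfolding dF_def by (rule has_derivative_smooth_function_comp[OF X \<phi> H that])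
  define K where "K j = vector_derivative \<sigma> (at (cs j * h))" for j
  let ?l = "lagrange_poly s cs"

  \<comment> \<open>The statement with \<open>has_integral\<close> includes integrability, which is
    needed to sum the contributions of the nodes.\<close>
  have zero: "((\<lambda>\<xi>. ?l j \<xi> * dF (\<sigma> (\<xi> * h)) (K j)) has_integral 0) {0..1}"
    if j: "j \<in> {1..s}" for j
  proof -
    define U where "U = \<phi> p (\<sigma> (cs j * h))"
    define L where "L = tangent_map A vector_atlas (inv_into V (\<phi> p)) U"
    define I where "I \<xi> = (?l j \<xi> / quad_weight s cs j) *\<^sub>R g_adjoint g U p L
        (g_adjoint g p (\<phi> p (\<sigma> (\<xi> * h))) (tangent_map vector_atlas A (\<phi> p) (\<sigma> (\<xi> * h)))
          (gradient A g H (\<phi> p (\<sigma> (\<xi> * h)))))" for \<xi>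
    define a where "a = integral {0..1} I"
    have UX: "U \<in> topspace X" unfolding U_def by (rule \<phi>X[OF V(2)[OF j]])
    have L: "linear L" unfolding L_def U_def by (rule lin_inv[OF V(2)[OF j]])
    have gU: "linear (\<lambda>v. g U v w)" for w
      using M UX unfolding riemannian_manifold_def bilinear_def by blast
    have K: "K j = L (\<Omega> U a)"
      unfolding K_def d\<sigma>[OF j] avg_gradient_def Let_def a_def I_def L_def U_def ..
    \<comment> \<open>The two adjoints move onto \<open>w\<close> one after the other and the
      gradient turns into the differential of \<open>H\<close>. Multiplying by the nonzero weight
      cancels the division in the averaged gradient.\<close>
    have gI: "quad_weight s cs j * g U (I \<xi>) w = ?l j \<xi> * dF (\<sigma> (\<xi> * h)) (L w)"
      if \<xi>: "\<xi> \<in> {0..1}" for \<xi> w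
      using weights j unfolding I_def linear_scale[OF gU] g_g_adjoint[OF M UX pX L]
        g_g_adjoint[OF M pX \<phi>X[OF V(1)[OF \<xi>]] lin_\<phi>[OF V(1)[OF \<xi>]]]
        g_gradient[OF M \<phi>X[OF V(1)[OF \<xi>]] lin_H[OF \<phi>X[OF V(1)[OF \<xi>]]]]
      by (simp add: dF_def)
    show ?thesis
    proof (cases "I integrable_on {0..1}")
      case True
      then have "(I has_integral a) {0..1}" unfolding a_def by (rule integrable_integral)
      \<comment> \<open>Boundedness of this functional lets it pass through the vector-valued
        integral that defines \<open>a\<close>.\<close>
      moreover have "bounded_linear (\<lambda>v. g U v (\<Omega> U a))"
        by (rule linear_imp_bounded_linear_finite_span[OF gU B])
      ultimately have "((\<lambda>\<xi>. g U (I \<xi>) (\<Omega> U a)) has_integral g U a (\<Omega> U a)) {0..1}"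
        using has_integral_linear[of I a "{0..1}" "\<lambda>v. g U v (\<Omega> U a)"] by (simp add: o_def)
      \<comment> \<open>Skew-symmetry at \<open>U\<close>, applied to the averaged gradient
        \<open>a\<close> itself, makes the integral vanish.\<close>
      then have "((\<lambda>\<xi>. quad_weight s cs j * g U (I \<xi>) (\<Omega> U a)) has_integral 0) {0..1}"
        using has_integral_mult_right[of _ "g U a (\<Omega> U a)" "{0..1}" "quad_weight s cs j"] \<Omega>(2) UX
        by (simp add: skew_symmetric_field_def)
      then show ?thesis
        by (rule has_integral_eq[rotated]) (simp add: gI K)
    next
      case False
      \<comment> \<open>the averaged gradient is then the junk value 0, so the stage velocity vanishes\<close>
      then have "a = 0" unfolding a_def by (rule not_integrable_integral)
      moreover have "linear (\<Omega> U)" using \<Omega>(1) UX by (simp add: tensor_field_1_1_def)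
      ultimately have "K j = 0" using L by (simp add: K linear_0)
      then have "dF (\<sigma> (\<xi> * h)) (K j) = 0" if "\<xi> \<in> {0..1}" for \<xi>
        using linear_0[OF has_derivative_linear[OF dF[OF V(1)[OF that]]]] by simp
      then show ?thesis
        by (intro has_integral_is_0) simp
    qed
  qed

  have deriv: "((\<lambda>\<xi>. H (\<phi> p (\<sigma> (\<xi> * h)))) has_vector_derivative
      (\<Sum>j\<in>{1..s}. h * (?l j \<xi> * dF (\<sigma> (\<xi> * h)) (K j)))) (at \<xi> within {0..1})"
    if \<xi>: "\<xi> \<in> {0..1}" for \<xi>
  proof -
    have lin: "linear (dF (\<sigma> (\<xi> * h)))"
      by (rule has_derivative_linear[OF dF[OF V(1)[OF \<xi>]]])
    have "((\<lambda>\<xi>. \<xi> * h) has_vector_derivative h) (at \<xi> within {0..1})"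
      by (auto intro!: derivative_eq_intros)
    moreover have "(\<sigma> has_vector_derivative vector_derivative \<sigma> (at (\<xi> * h)))
        (at (\<xi> * h) within (\<lambda>\<xi>. \<xi> * h) ` {0..1})"
      by (rule has_vector_derivative_at_within[OF vector_poly_differentiable[OF \<sigma>]])
    ultimately have "((\<sigma> \<circ> (\<lambda>\<xi>. \<xi> * h)) has_vector_derivative
        h *\<^sub>R vector_derivative \<sigma> (at (\<xi> * h))) (at \<xi> within {0..1})"
      by (rule vector_diff_chain_within)
    moreover have "((H \<circ> \<phi> p) has_derivative dF ((\<sigma> \<circ> (\<lambda>\<xi>. \<xi> * h)) \<xi>))
        (at ((\<sigma> \<circ> (\<lambda>\<xi>. \<xi> * h)) \<xi>) within (\<sigma> \<circ> (\<lambda>\<xi>. \<xi> * h)) ` {0..1})"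
      using dF[OF V(1)[OF \<xi>]] by (simp add: has_derivative_at_withinI)
    ultimately have "((H \<circ> \<phi> p \<circ> (\<sigma> \<circ> (\<lambda>\<xi>. \<xi> * h))) has_vector_derivative
        dF ((\<sigma> \<circ> (\<lambda>\<xi>. \<xi> * h)) \<xi>) (h *\<^sub>R vector_derivative \<sigma> (at (\<xi> * h)))) (at \<xi> within {0..1})"
      by (rule vector_derivative_diff_chain_within)
    moreover have "vector_derivative \<sigma> (at (\<xi> * h)) = (\<Sum>j\<in>{1..s}. ?l j \<xi> *\<^sub>R K j)"
      unfolding K_def by (rule vector_derivative_vector_poly_interpolation[OF \<sigma> inj])
    ultimately show ?thesis
      by (simp add: o_def linear_scale[OF lin] linear_sum[OF lin] sum_distrib_left)
  qed
  \<comment> \<open>For the gauge integral, a derivative at every point of [0,1] is enough: the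
    fundamental theorem also yields integrability of the derivative.\<close>
  have "((\<lambda>\<xi>. \<Sum>j\<in>{1..s}. h * (?l j \<xi> * dF (\<sigma> (\<xi> * h)) (K j))) has_integral
      H (\<phi> p (\<sigma> (1 * h))) - H (\<phi> p (\<sigma> (0 * h)))) {0..1}"
    by (rule fundamental_theorem_of_calculus[OF _ deriv]) simp_all
  moreover have "((\<lambda>\<xi>. \<Sum>j\<in>{1..s}. h * (?l j \<xi> * dF (\<sigma> (\<xi> * h)) (K j))) has_integral
      (\<Sum>j\<in>{1..s}. h * 0)) {0..1}"
    by (intro has_integral_sum has_integral_mult_right zero) auto
  ultimately have "H (\<phi> p (\<sigma> (1 * h))) - H (\<phi> p (\<sigma> (0 * h))) = (\<Sum>j\<in>{1..s}. h * 0)"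
    by (rule has_integral_unique)
  \<comment> \<open>At the left end, \<open>\<sigma> 0\<close> is a preimage of \<open>u0\<close>
    because \<open>u0\<close> lies in the image of \<open>V\<close>; at the right end,
    \<open>u1\<close> is the value at \<open>\<sigma> h\<close>.\<close>
  then show ?thesis using u0 u1 by (simp add: f_inv_into_f)
qed

theorem mainTheorem2:
  fixes X :: "'a topology"
    and A :: "('a, 'e::banach) chart set"
    and g :: "'a \<Rightarrow> 'e \<Rightarrow> 'e \<Rightarrow> real"
    and H :: "'a \<Rightarrow> real"
    and \<Omega> :: "'a \<Rightarrow> 'e \<Rightarrow> 'e"
    and D :: "('a \<times> 'e) set"
    and \<phi> :: "'a \<Rightarrow> 'e \<Rightarrow> 'a"
    and c :: "'a \<Rightarrow> 'a \<Rightarrow> 'a"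
    and s :: nat
    and cs :: "nat \<Rightarrow> real"
    and h :: real
  assumes "riemannian_manifold X A g"
    and "smooth_function X A H"
    and "tensor_field_1_1 X \<Omega>"
    and "skew_symmetric_field X g \<Omega>"
    and "mfd_retraction X A g D \<phi>"
    and "center_point X c"
    and "inj_on cs {1..s}"
    and "\<forall>i\<in>{1..s}. quad_weight s cs i \<noteq> 0"
    and "h > 0"
  shows "(\<forall>u0 u1. ep_collocation_step X A g H \<Omega> D \<phi> c s cs h u0 u1 \<longrightarrow> H u1 = H u0) \<and>
         (\<forall>u. (\<forall>k. ep_collocation_step X A g H \<Omega> D \<phi> c s cs h (u k) (u (Suc k))) \<longrightarrow>
              (\<forall>k. H (u k) = H (u 0)))"
proof (intro conjI allI impI)
  have step: "H u1 = H u0" if "ep_collocation_step X A g H \<Omega> D \<phi> c s cs h u0 u1" for u0 u1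
    using ep_collocation_step_preserves[OF assms(1-4,6-8) that] .
  then show "H u1 = H u0" if "ep_collocation_step X A g H \<Omega> D \<phi> c s cs h u0 u1" for u0 u1
    using that .
  fix u :: "nat \<Rightarrow> 'a" and k
  assume steps: "\<forall>k. ep_collocation_step X A g H \<Omega> D \<phi> c s cs h (u k) (u (Suc k))"
  show "H (u k) = H (u 0)"
    by (induction k) (simp_all add: step[OF steps[rule_format]])
qed

end
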